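(* Let $F$ be the face $(U_{2,3}^{123},U_{1,3}^{124})$ of $\Gamma_4$. For real $a,b\ge 0$, the point $\mathbf h=(a,b)\in F$ is entropic if and only if $a=\log v$ for some integer $v\ge 1$.
   Context: $N_4=\{1,2,3,4\}$. $\Gamma_4$ is the cone of all polymatroid rank functions on $N_4$. A set function $\mathbf h:2^{N_4}\to\mathbb R$ is called entropic if there is a random vector $(X_1,X_2,X_3,X_4)$, each $X_i$ taking values in a finite set, with $\mathbf h(A)=H(X_A)$ for all $A\subseteq N_4$, where $H$ is Shannon entropy, $X_A=(X_j,j\in A)$ and $\mathbf h(\emptyset)=0$. Logarithms (also in the entropy) are to base $2$. For two (poly)matroids $M_1,M_2$ on $N_4$ with rank functions $\mathbf r_1,\mathbf r_2$, $(M_1,M_2)$ denotes the face $\{a\mathbf r_1+b\mathbf r_2:a,b\ge0\}$ of $\Gamma_4$, and $(a,b)$ denotes the point $a\mathbf r_1+b\mathbf r_2$. For $\alpha\subseteq N_4$ with $|\alpha|=m$, $U^\alpha_{k,m}$ is the matroid on $N_4$ with rank function $\mathbf r(A)=\min\{k,|A\cap\alpha|\}$. Superscripts such as $123$ abbreviate $\{1,2,3\}$. *)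

theory Defs
  imports "HOL-Probability.Information"
begin

definition N4 :: "nat set" where
  "N4 = {1, 2, 3, 4}"

text \<open>
  A set function on the subsets of \<^term>\<open>N4\<close> is represented by a total function \<^term>\<open>h\<close> with
  \<^prop>\<open>h A = h (A \<inter> N4)\<close> for all \<^term>\<open>A\<close>; in this way set functions form a vector space under
  the pointwise operations and are determined by their values on \<^term>\<open>Pow N4\<close>.
\<close>

definition Gamma4 :: "(nat set \<Rightarrow> real) set" where
  "Gamma4 = {h. (\<forall>A. h A = h (A \<inter> N4)) \<and> h {} = 0 \<and>
     (\<forall>A B. A \<subseteq> B \<and> B \<subseteq> N4 \<longrightarrow> h A \<le> h B) \<and>
     (\<forall>A B. A \<subseteq> N4 \<and> B \<subseteq> N4 \<longrightarrow> h (A \<union> B) + h (A \<inter> B) \<le> h A + h B)}"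

definition uniform_rank :: "nat \<Rightarrow> nat set \<Rightarrow> nat set \<Rightarrow> real" where
  "uniform_rank k \<alpha> A = real (min k (card (A \<inter> \<alpha>)))"

definition pair_point ::
    "(nat set \<Rightarrow> real) \<Rightarrow> (nat set \<Rightarrow> real) \<Rightarrow> real \<Rightarrow> real \<Rightarrow> nat set \<Rightarrow> real" where
  "pair_point r1 r2 a b = (\<lambda>A. a * r1 A + b * r2 A)"

definition pair_face ::
    "(nat set \<Rightarrow> real) \<Rightarrow> (nat set \<Rightarrow> real) \<Rightarrow> (nat set \<Rightarrow> real) set" where
  "pair_face r1 r2 = {pair_point r1 r2 a b | a b. 0 \<le> a \<and> 0 \<le> b}"

text \<open>
  Lemmas \<open>pair_face_subset_Gamma4\<close> and \<open>pair_face_is_face\<close> below justify calling this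
  particular \<^const>\<open>pair_face\<close> a face of the cone \<^const>\<open>Gamma4\<close>.
\<close>

lemma pair_point_expand:
  fixes h a b
  defines "h \<equiv> pair_point (uniform_rank 2 {1, 2, 3}) (uniform_rank 1 {1, 2, 4}) a b"
  shows "h {} = 0" "h {1} = a + b" "h {2} = a + b" "h {3} = a" "h {4} = b"
    "h {1,2} = 2*a + b" "h {1,3} = 2*a + b" "h {1,4} = a + b" "h {2,3} = 2*a + b" "h {2,4} = a + b"
    "h {3,4} = a + b" "h {1,2,3} = 2*a + b" "h {1,2,4} = 2*a + b" "h {1,3,4} = 2*a + b"
    "h {2,3,4} = 2*a + b" "h {1,2,3,4} = 2*a + b"
  by (simp_all add: h_def pair_point_def uniform_rank_def Int_insert_left)

lemma subset_N4_cases: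
  assumes "A \<subseteq> N4"
  shows "A \<in> {{}, {1}, {2}, {3}, {4}, {1,2}, {1,3}, {1,4}, {2,3}, {2,4}, {3,4},
    {1,2,3}, {1,2,4}, {1,3,4}, {2,3,4}, {1,2,3,4}}"
proof -
  have "A \<in> Pow {1, 2, 3, 4}" using assms by (simp add: N4_def)
  then show ?thesis
    unfolding Pow_insert Pow_empty image_insert image_empty Un_insert_left Un_empty_left
      insert_iff empty_iff
    by argo
qed

lemma Gamma4D:
  assumes "h \<in> Gamma4"
  shows "h A = h (A \<inter> N4)" and "h {} = 0"
    and "A \<subseteq> B \<Longrightarrow> B \<subseteq> N4 \<Longrightarrow> h A \<le> h B"
    and "A \<subseteq> N4 \<Longrightarrow> B \<subseteq> N4 \<Longrightarrow> h (A \<union> B) + h (A \<inter> B) \<le> h A + h B"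
proof -
  note c = assms[unfolded Gamma4_def mem_Collect_eq]
  show "h A = h (A \<inter> N4)" by (rule c[THEN conjunct1, THEN spec])
  show "h {} = 0" by (rule c[THEN conjunct2, THEN conjunct1])
  show "A \<subseteq> B \<Longrightarrow> B \<subseteq> N4 \<Longrightarrow> h A \<le> h B"
    using c[THEN conjunct2, THEN conjunct2, THEN conjunct1] by blast
  show "A \<subseteq> N4 \<Longrightarrow> B \<subseteq> N4 \<Longrightarrow> h (A \<union> B) + h (A \<inter> B) \<le> h A + h B"
    using c[THEN conjunct2, THEN conjunct2, THEN conjunct2] by blast
qed

lemma pair_face_is_face:
  fixes x y :: "nat set \<Rightarrow> real"
  defines "F \<equiv> pair_face (uniform_rank 2 {1, 2, 3}) (uniform_rank 1 {1, 2, 4})"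
  assumes x: "x \<in> Gamma4" and y: "y \<in> Gamma4" and xy: "(\<lambda>A. x A + y A) \<in> F"
  shows "x \<in> F"
proof -
  define p where "p = pair_point (uniform_rank 2 {1, 2, 3}) (uniform_rank 1 {1, 2, 4})"
  obtain a b where sum: "(\<lambda>A. x A + y A) = p a b"
    using xy by (auto simp: F_def pair_face_def p_def)
  have S: "x A + y A = p a b A" for A using fun_cong[OF sum] by simp
  have m: "h A \<le> h B" if "A \<subseteq> B" "B \<subseteq> N4" "h \<in> Gamma4" for h A B
    by (rule Gamma4D(3)[OF that(3,1,2)])
  have sm: "h (A \<union> B) + h (A \<inter> B) \<le> h A + h B" if "A \<subseteq> N4" "B \<subseteq> N4" "h \<in> Gamma4" for h A B
    by (rule Gamma4D(4)[OF that(3,1,2)])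
  have z: "h {} = 0" if "h \<in> Gamma4" for h by (rule Gamma4D(2)[OF that])
  note E = pair_point_expand[of a b, folded p_def]
  have mono: "h {1,2} \<le> h {1,2,3}" "h {1,3} \<le> h {1,2,3}" "h {2,3} \<le> h {1,2,3}"
    "h {1,2} \<le> h {1,2,4}" "h {1,3} \<le> h {1,3,4}" "h {2,3} \<le> h {2,3,4}"
    "h {1,2,3} \<le> h {1,2,3,4}" "h {1,2,4} \<le> h {1,2,3,4}" "h {1,3,4} \<le> h {1,2,3,4}"
    "h {2,3,4} \<le> h {1,2,3,4}" "h {1} \<le> h {1,4}" "h {2} \<le> h {2,4}" "h {} \<le> h {3}" "h {} \<le> h {4}"
    if h: "h \<in> Gamma4" for h
    by ((rule m[OF _ _ h]; auto simp: N4_def)+)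
  have subm: "h {1,3} + h {} \<le> h {1} + h {3}" "h {2,3} + h {} \<le> h {2} + h {3}"
    "h {3,4} + h {} \<le> h {3} + h {4}" "h {1,2,4} + h {4} \<le> h {1,4} + h {2,4}"
    "h {1,3,4} + h {4} \<le> h {1,4} + h {3,4}" "h {2,3,4} + h {4} \<le> h {2,4} + h {3,4}"
    if h: "h \<in> Gamma4" for h
    using sm[OF _ _ h, of "{1}" "{3}"] sm[OF _ _ h, of "{2}" "{3}"] sm[OF _ _ h, of "{3}" "{4}"]
      sm[OF _ _ h, of "{1,4}" "{2,4}"] sm[OF _ _ h, of "{1,4}" "{3,4}"]
      sm[OF _ _ h, of "{2,4}" "{3,4}"]
    by (simp_all add: N4_def insert_commute)
  have tm: "x A = x B" if "x A \<le> x B" "y A \<le> y B" "p a b A = p a b B" for A B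
    using that S[of A] S[of B] by linarith
  have ts: "x A + x B = x C + x D"
    if "x A + x B \<le> x C + x D" "y A + y B \<le> y C + y D"
      "p a b A + p a b B = p a b C + p a b D" for A B C D
    using that S[of A] S[of B] S[of C] S[of D] by linarith
  have pos: "0 \<le> x {3}" "0 \<le> x {4}"
    using mono(13,14)[OF x] z[OF x] by auto
  have eqs:
    "x {1,2} = x {1,2,3}"
    "x {1,3} = x {1,2,3}"
    "x {2,3} = x {1,2,3}"
    "x {1,2} = x {1,2,4}"
    "x {1,3} = x {1,3,4}"
    "x {2,3} = x {2,3,4}"
    "x {1,2,3} = x {1,2,3,4}"
    "x {1} = x {1,4}"
    "x {2} = x {2,4}"
    "x {1,3} + x {} = x {1} + x {3}"
    "x {2,3} + x {} = x {2} + x {3}"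
    "x {3,4} + x {} = x {3} + x {4}"
    "x {1,2,4} + x {4} = x {1,4} + x {2,4}"
    by ((rule
      tm[OF mono(1)[OF x] mono(1)[OF y]]
      tm[OF mono(2)[OF x] mono(2)[OF y]]
      tm[OF mono(3)[OF x] mono(3)[OF y]]
      tm[OF mono(4)[OF x] mono(4)[OF y]]
      tm[OF mono(5)[OF x] mono(5)[OF y]]
      tm[OF mono(6)[OF x] mono(6)[OF y]]
      tm[OF mono(7)[OF x] mono(7)[OF y]]
      tm[OF mono(11)[OF x] mono(11)[OF y]]
      tm[OF mono(12)[OF x] mono(12)[OF y]]
      ts[OF subm(1)[OF x] subm(1)[OF y]]
      ts[OF subm(2)[OF x] subm(2)[OF y]]
      ts[OF subm(3)[OF x] subm(3)[OF y]]
      ts[OF subm(4)[OF x] subm(4)[OF y]]; simp add: E del: One_nat_def)+)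
  have v: "x {1} = x {3} + x {4}" "x {2} = x {3} + x {4}" "x {1,2} = 2 * x {3} + x {4}"
    "x {1,3} = 2 * x {3} + x {4}" "x {1,4} = x {3} + x {4}" "x {2,3} = 2 * x {3} + x {4}"
    "x {2,4} = x {3} + x {4}" "x {3,4} = x {3} + x {4}" "x {1,2,3} = 2 * x {3} + x {4}"
    "x {1,2,4} = 2 * x {3} + x {4}" "x {1,3,4} = 2 * x {3} + x {4}"
    "x {2,3,4} = 2 * x {3} + x {4}" "x {1,2,3,4} = 2 * x {3} + x {4}"
    using eqs z[OF x] by linarith+
  have "x A = p (x {3}) (x {4}) A" for A
  proof -
    have "x B = p (x {3}) (x {4}) B" if "B \<subseteq> N4" for B
      using subset_N4_cases[OF that] unfolding insert_iff empty_iff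
      by (elim disjE FalseE)
        (simp_all only: v z[OF x] pair_point_expand[of "x {3}" "x {4}", folded p_def])
    then have "x (A \<inter> N4) = p (x {3}) (x {4}) (A \<inter> N4)" by simp
    moreover have "x A = x (A \<inter> N4)" by (rule Gamma4D(1)[OF x])
    moreover have "p c d A = p c d (A \<inter> N4)" for c d
    proof -
      have "A \<inter> N4 \<inter> {1, 2, 3} = A \<inter> {1, 2, 3}" "A \<inter> N4 \<inter> {1, 2, 4} = A \<inter> {1, 2, 4}"
        by (auto simp: N4_def)
      then show ?thesis by (simp add: p_def pair_point_def uniform_rank_def)
    qed
    ultimately show ?thesis by simp
  qed
  then have "x = p (x {3}) (x {4})" by blast
  with pos show ?thesis unfolding F_def pair_face_def p_def by blast
qed

lemma pair_face_subset_Gamma4: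
  "pair_face (uniform_rank 2 {1, 2, 3}) (uniform_rank 1 {1, 2, 4}) \<subseteq> Gamma4"
proof -
  have u: "uniform_rank k \<alpha> \<in> Gamma4" if \<alpha>: "\<alpha> \<subseteq> N4" for k \<alpha>
  proof -
    have fin: "finite \<alpha>" using \<alpha> by (auto simp: N4_def intro: finite_subset)
    have loc: "A \<inter> N4 \<inter> \<alpha> = A \<inter> \<alpha>" for A using \<alpha> by auto
    have mono: "card (A \<inter> \<alpha>) \<le> card (B \<inter> \<alpha>)" if "A \<subseteq> B" for A B
      using fin that by (intro card_mono) auto
    have mono2: "min k (card (A \<inter> \<alpha>)) \<le> card (B \<inter> \<alpha>)" if "A \<subseteq> B" for A B
      using mono[OF that] by linarith
    have sub: "min k (card ((A \<union> B) \<inter> \<alpha>)) + min k (card (A \<inter> B \<inter> \<alpha>)) \<le>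
        min k (card (A \<inter> \<alpha>)) + min k (card (B \<inter> \<alpha>))" for A B
    proof -
      have "(A \<union> B) \<inter> \<alpha> = (A \<inter> \<alpha>) \<union> (B \<inter> \<alpha>)" "A \<inter> B \<inter> \<alpha> = (A \<inter> \<alpha>) \<inter> (B \<inter> \<alpha>)"
        by auto
      then have "card ((A \<union> B) \<inter> \<alpha>) + card (A \<inter> B \<inter> \<alpha>) = card (A \<inter> \<alpha>) + card (B \<inter> \<alpha>)"
        using card_Un_Int[of "A \<inter> \<alpha>" "B \<inter> \<alpha>"] fin by simp
      moreover have "card (A \<inter> B \<inter> \<alpha>) \<le> card (A \<inter> \<alpha>)" "card (A \<inter> B \<inter> \<alpha>) \<le> card (B \<inter> \<alpha>)"
        by (auto intro: mono)
      ultimately show ?thesis by linarith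
    qed
    show ?thesis
      unfolding Gamma4_def uniform_rank_def
      using sub mono2 by (simp add: loc flip: of_nat_add)
  qed
  have pp: "pair_point r s a b \<in> Gamma4" if "r \<in> Gamma4" "s \<in> Gamma4" "0 \<le> a" "0 \<le> b" for r s a b
  proof -
    have r: "r A = r (A \<inter> N4)" "s A = s (A \<inter> N4)" "r {} = 0" "s {} = 0" for A
      by (rule Gamma4D(1,2)[OF that(1)] Gamma4D(1,2)[OF that(2)])+
    have rmono: "r A \<le> r B" "s A \<le> s B" if "A \<subseteq> B" "B \<subseteq> N4" for A B
      by (rule Gamma4D(3)[OF \<open>r \<in> _\<close> that] Gamma4D(3)[OF \<open>s \<in> _\<close> that])+
    have rsub: "r (A \<union> B) + r (A \<inter> B) \<le> r A + r B" "s (A \<union> B) + s (A \<inter> B) \<le> s A + s B"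
      if "A \<subseteq> N4" "B \<subseteq> N4" for A B
      by (rule Gamma4D(4)[OF \<open>r \<in> _\<close> that] Gamma4D(4)[OF \<open>s \<in> _\<close> that])+
    have sub: "a * r (A \<union> B) + b * s (A \<union> B) + (a * r (A \<inter> B) + b * s (A \<inter> B))
        \<le> a * r A + b * s A + (a * r B + b * s B)" if "A \<subseteq> N4" "B \<subseteq> N4" for A B
      using mult_left_mono[OF rsub(1)[OF that] \<open>0 \<le> a\<close>] mult_left_mono[OF rsub(2)[OF that] \<open>0 \<le> b\<close>]
      by (simp add: distrib_left)
    have mo: "a * r A + b * s A \<le> a * r B + b * s B" if "A \<subseteq> B" "B \<subseteq> N4" for A B
      by (intro add_mono mult_left_mono rmono[OF that] \<open>0 \<le> a\<close> \<open>0 \<le> b\<close>)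
    have z: "a * r {} + b * s {} = 0" by (simp add: r(3,4))
    have loc: "a * r A + b * s A = a * r (A \<inter> N4) + b * s (A \<inter> N4)" for A
      using r(1)[of A] r(2)[of A] by simp
    show ?thesis
      unfolding Gamma4_def pair_point_def mem_Collect_eq
      by (intro conjI allI impI; (elim conjE)?) (rule loc z mo sub; assumption)+
  qed
  have N: "{1, 2, 3} \<subseteq> N4" "{1, 2, 4} \<subseteq> N4" unfolding N4_def by blast+
  show ?thesis
    unfolding pair_face_def by (rule subsetI) (elim CollectE exE conjE; simp only: pp u N)
qed

text \<open>
  \<^term>\<open>subvector X A \<omega>\<close> is the value at \<^term>\<open>\<omega>\<close> of the random vector with components
  \<^term>\<open>X j\<close>, \<^term>\<open>j \<in> A\<close>; for empty \<^term>\<open>A\<close> it is constant.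
\<close>

definition subvector :: "(nat \<Rightarrow> 'w \<Rightarrow> 'x) \<Rightarrow> nat set \<Rightarrow> 'w \<Rightarrow> nat \<Rightarrow> 'x" where
  "subvector X A \<omega> = restrict (\<lambda>j. X j \<omega>) A"

definition entropy_represents ::
    "'w measure \<Rightarrow> (nat \<Rightarrow> 'w \<Rightarrow> 'x) \<Rightarrow> (nat set \<Rightarrow> real) \<Rightarrow> bool" where
  "entropy_represents M X h \<longleftrightarrow>
     prob_space M \<and> (\<forall>i\<in>N4. simple_function M (X i)) \<and>
     (\<forall>A\<subseteq>N4. h A =
        prob_space.entropy M 2 (count_space (subvector X A ` space M)) (subvector X A))"

text \<open>
  HOL cannot quantify over types inside a definition, so sample space and values are taken in
  \<^typ>\<open>nat\<close>; lemma \<open>entropicI\<close> below shows that this is no restriction.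
\<close>

definition entropic :: "(nat set \<Rightarrow> real) \<Rightarrow> bool" where
  "entropic h \<longleftrightarrow> (\<exists>(M :: nat measure) (X :: nat \<Rightarrow> nat \<Rightarrow> nat). entropy_represents M X h)"

lemma entropy_simple:
  assumes "prob_space M" "simple_function M Z"
  shows "prob_space.entropy M 2 (count_space (Z ` space M)) Z =
    - (\<Sum>z\<in>Z ` space M. measure M (Z -` {z} \<inter> space M) * log 2 (measure M (Z -` {z} \<inter> space M)))"
proof -
  interpret information_space M 2
    using assms(1) by (simp add: information_space_def information_space_axioms_def)
  show ?thesis
    by (rule entropy_simple_distributed[OF simple_distributedI[OF assms(2) measure_nonneg refl]])
qed

lemma simple_function_subvector:
  assumes "\<forall>i\<in>N4. simple_function M (X i)" "A \<subseteq> N4"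
  shows "simple_function M (subvector X A)"
proof -
  have fA: "finite A" using assms(2) by (auto simp: N4_def intro: finite_subset)
  have img: "subvector X A ` space M \<subseteq> PiE A (\<lambda>i. X i ` space M)"
    by (auto simp: subvector_def)
  have fin: "finite (subvector X A ` space M)"
    by (rule finite_subset[OF img], rule finite_PiE[OF fA])
       (use assms in \<open>auto simp: simple_function_def\<close>)
  have "subvector X A -` {z} \<inter> space M \<in> sets M" if z: "z \<in> subvector X A ` space M" for z
  proof -
    have "subvector X A -` {z} \<inter> space M = {w \<in> space M. \<forall>i\<in>A. X i w = z i}"
    proof -
      have "z \<in> extensional A" using z by (auto simp: subvector_def)
      then have "subvector X A w = z \<longleftrightarrow> (\<forall>i\<in>A. X i w = z i)" for w
        by (fastforce simp: subvector_def extensional_def restrict_def fun_eq_iff)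
      then show ?thesis by auto
    qed
    also have "\<dots> \<in> sets M"
    proof (rule sets.sets_Collect_finite_All[OF _ fA])
      show "{w \<in> space M. X i w = z i} \<in> sets M" if "i \<in> A" for i
      proof -
        have s: "simple_function M (X i)" using assms that by auto
        have "X i -` {z i} \<inter> space M \<in> sets M" by (rule simple_functionD(2)[OF s])
        moreover have "X i -` {z i} \<inter> space M = {w \<in> space M. X i w = z i}" by auto
        ultimately show ?thesis by simp
      qed
    qed
    finally show ?thesis .
  qed
  with fin show ?thesis by (simp add: simple_function_def)
qed

lemma entropy_represents_empty:
  assumes "entropy_represents M X h"
  shows "h {} = 0"
proof -
  have P: "prob_space M" and s: "\<forall>i\<in>N4. simple_function M (X i)"
    and h: "h {} = prob_space.entropy M 2 (count_space (subvector X {} ` space M)) (subvector X {})"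
    using assms by (auto simp: entropy_represents_def)
  interpret prob_space M by (rule P)
  have "subvector X {} = (\<lambda>w j. undefined)"
    by (auto simp: subvector_def restrict_def)
  then have "subvector X {} ` space M = {\<lambda>j. undefined}"
    and "subvector X {} -` {\<lambda>j. undefined} \<inter> space M = space M"
    using not_empty by auto
  then show ?thesis
    using h entropy_simple[OF P simple_function_subvector[OF s, of "{}"]] by (simp add: prob_space)
qed

lemma entropicI:
  fixes M :: "'w measure" and X :: "nat \<Rightarrow> 'w \<Rightarrow> 'x"
  assumes "entropy_represents M X h"
  shows "entropic h"
proof -
  have P: "prob_space M" and s: "\<forall>i\<in>N4. simple_function M (X i)"
    and h: "\<And>A. A \<subseteq> N4 \<Longrightarrow> h A =
      prob_space.entropy M 2 (count_space (subvector X A ` space M)) (subvector X A)"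
    using assms by (auto simp: entropy_represents_def)
  interpret prob_space M by (rule P)
  define S where "S = subvector X N4"
  have sS: "simple_function M S"
    unfolding S_def by (rule simple_function_subvector[OF s]) simp
  define R where "R = S ` space M"
  have finR: "finite R" using sS by (simp add: R_def simple_function_def)
  define g where "g = to_nat_on R"
  have injg: "inj_on g R"
    unfolding g_def by (rule inj_on_to_nat_on[OF countable_finite[OF finR]])
  define e where "e = to_nat_on (\<Union>i\<in>N4. X i ` space M)"
  have "finite (\<Union>i\<in>N4. X i ` space M)"
    using s by (auto simp: N4_def simple_function_def)
  then have inje: "inj_on e (\<Union>i\<in>N4. X i ` space M)"
    unfolding e_def by (intro inj_on_to_nat_on countable_finite)
  define T where "T = (\<lambda>w. g (S w))"
  have finT: "finite (T ` space M)" using finR by (simp add: T_def R_def flip: image_image)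
  have sT: "simple_function M T"
    using simple_function_compose[OF sS, of g] by (simp add: T_def comp_def)
  have Tm: "T \<in> M \<rightarrow>\<^sub>M count_space (T ` space M)"
    unfolding measurable_count_space_eq2[OF finT] using sT by (auto simp: simple_function_def)
  define M' where "M' = distr M (count_space (T ` space M)) T"
  define X' where "X' i k = e (the_inv_into R g k i)" for i k
  have P': "prob_space M'" unfolding M'_def by (rule prob_space_distr[OF Tm])
  have spM': "space M' = T ` space M" by (simp add: M'_def)
  have setsM': "sets M' = Pow (T ` space M)" by (simp add: M'_def)
  have s': "simple_function M' Z" for Z :: "nat \<Rightarrow> 'c"
    using finT by (auto simp: simple_function_def spM' setsM')
  have XT: "X' i (T w) = e (X i w)" if "i \<in> N4" "w \<in> space M" for i w
    using that injg by (simp add: X'_def T_def the_inv_into_f_f R_def)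
       (simp add: S_def subvector_def)
  have "h A = prob_space.entropy M' 2 (count_space (subvector X' A ` space M')) (subvector X' A)"
    if A: "A \<subseteq> N4" for A
  proof -
    define Z where "Z = subvector X A"
    define Z' where "Z' = subvector X' A"
    define f where "f z = restrict (\<lambda>i. e (z i)) A" for z :: "nat \<Rightarrow> 'x"
    have Zf: "Z' (T w) = f (Z w)" if "w \<in> space M" for w
      using that A XT by (auto simp: Z'_def Z_def f_def subvector_def restrict_def fun_eq_iff)
    have inj: "inj_on f (Z ` space M)"
    proof (rule inj_onI, clarify)
      fix v w assume vw: "v \<in> space M" "w \<in> space M" and eq: "f (Z v) = f (Z w)"
      have "X i v = X i w" if "i \<in> A" for i
      proof -
        have "e (X i v) = e (X i w)"
          using fun_cong[OF eq, of i] that by (simp add: f_def Z_def subvector_def)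
        then show ?thesis
          using inj_onD[OF inje] vw that A by blast
      qed
      then show "Z v = Z w" by (auto simp: Z_def subvector_def restrict_def)
    qed
    have img: "Z' ` space M' = f ` Z ` space M"
      using Zf by (auto simp: spM' image_iff)
    have meas: "measure M' (Z' -` {f z} \<inter> space M') = measure M (Z -` {z} \<inter> space M)"
      if z: "z \<in> Z ` space M" for z
    proof -
      have "measure M' (Z' -` {f z} \<inter> space M') =
          measure M (T -` (Z' -` {f z} \<inter> space M') \<inter> space M)"
        unfolding M'_def by (rule measure_distr[OF Tm]) auto
      also have "T -` (Z' -` {f z} \<inter> space M') \<inter> space M = Z -` {z} \<inter> space M"
      proof -
        have "f (Z w) = f z \<longleftrightarrow> Z w = z" if "w \<in> space M" for w
          using inj_on_eq_iff[OF inj _ z] that by blast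
        then have "Z' (T w) = f z \<longleftrightarrow> Z w = z" if "w \<in> space M" for w
          using Zf[OF that] that by simp
        then show ?thesis by (auto simp only: spM' vimage_def Int_iff mem_Collect_eq singleton_iff image_eqI)
      qed
      finally show ?thesis .
    qed
    have sZ: "simple_function M Z"
      unfolding Z_def by (rule simple_function_subvector[OF s A])
    have "prob_space.entropy M 2 (count_space (Z ` space M)) Z =
        prob_space.entropy M' 2 (count_space (Z' ` space M')) Z'"
      unfolding entropy_simple[OF P sZ] entropy_simple[OF P' s'[of Z']] unfolding img
      by (simp add: sum.reindex[OF inj] meas)
    then show ?thesis using h[OF A] by (simp add: Z_def Z'_def)
  qed
  then have "entropy_represents M' X' h"
    using P' by (simp add: entropy_represents_def s')
  then show ?thesis unfolding entropic_def by blast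
qed

end

(*
  If (a, b) is represented by X1, ..., X4, then X4 is a function of X1 and of X2, any two of
  X1, X2, X3 determine the whole vector, X1 and X2 are conditionally independent given X4, and
  X3 is independent of X1 and of X2.  Hence on the support
    P(x1) P(x2) = P(x1,x2,x4) P(x4) = P(x2,x3) P(x4) = P(x2) P(x3) P(x4),
  so P(x3) = P(x1) / P(x4), which depends on x1 only.  By independence every value x3 occurs
  together with a given x1, so X3 is uniform on v values and a = H(X3) = log v.
  Conversely take U, V uniform on Z/v and Z of entropy b, all independent, and
  X1 = (U, Z), X2 = (V, Z), X3 = U + V, X4 = Z.
*)

theory Submission
  imports Defs "HOL-Real_Asymp.Real_Asymp"
begin

section \<open>Entropy of functions on a finite weighted set\<close>

definition mass :: "'a set \<Rightarrow> ('a \<Rightarrow> real) \<Rightarrow> ('a \<Rightarrow> 'b) \<Rightarrow> 'a \<Rightarrow> real" where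
  "mass \<Omega> p f x = sum p {y \<in> \<Omega>. f y = f x}"

text \<open>Shannon entropy written over sample points instead of values: grouping the points by the
  value of \<open>f\<close> gives the usual sum. All functions then share one index set, so their
  entropies can be compared term by term.\<close>

definition ent :: "'a set \<Rightarrow> ('a \<Rightarrow> real) \<Rightarrow> ('a \<Rightarrow> 'b) \<Rightarrow> real" where
  "ent \<Omega> p f = - (\<Sum>x\<in>\<Omega>. p x * log 2 (mass \<Omega> p f x))"

lemma mass_cong: "f x = f y \<Longrightarrow> mass \<Omega> p f x = mass \<Omega> p f y"
  by (simp add: mass_def)

text \<open>Strict positivity is what turns a vanishing sum of nonnegative terms into an equality at
  every point.\<close>

locale positive_weights =
  fixes \<Omega> :: "'a set" and p :: "'a \<Rightarrow> real"
  assumes fin: "finite \<Omega>" and pos: "x \<in> \<Omega> \<Longrightarrow> 0 < p x" and total: "sum p \<Omega> = 1"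
begin

abbreviation "m \<equiv> mass \<Omega> p"

lemma mass_pos: "x \<in> \<Omega> \<Longrightarrow> 0 < m f x"
  unfolding mass_def using fin by (intro sum_pos pos) auto

lemma mass_mono:
  assumes "\<And>y. y \<in> \<Omega> \<Longrightarrow> g y = g x \<Longrightarrow> f y = f x"
  shows "m g x \<le> m f x"
  unfolding mass_def using assms fin
  by (intro sum_mono2) (auto intro: less_imp_le pos)

section \<open>Equality cases of monotonicity and submodularity of entropy\<close>

text \<open>Fibres of the finer \<open>g\<close> lie inside those of \<open>f\<close>, so the
  difference of the entropies is a sum of nonnegative terms; if it vanishes, every term
  does.\<close>

lemma mass_eq_if_ent_eq:
  assumes coarser: "\<And>x y. x \<in> \<Omega> \<Longrightarrow> y \<in> \<Omega> \<Longrightarrow> g y = g x \<Longrightarrow> f y = f x"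
    and eq: "ent \<Omega> p f = ent \<Omega> p g" and x: "x \<in> \<Omega>"
  shows "m f x = m g x"
proof -
  have le: "0 \<le> p y * (log 2 (m f y) - log 2 (m g y))" if "y \<in> \<Omega>" for y
  proof -
    have "m g y \<le> m f y" by (rule mass_mono) (rule coarser[OF that])
    then show ?thesis using mass_pos[OF that, of g] pos[OF that] by simp
  qed
  have "(\<Sum>y\<in>\<Omega>. p y * (log 2 (m f y) - log 2 (m g y))) = 0"
    using eq by (simp add: ent_def right_diff_distrib sum_subtractf)
  then have "p x * (log 2 (m f x) - log 2 (m g x)) = 0"
    using x le fin by (simp add: sum_nonneg_eq_0_iff)
  then have "log 2 (m f x) = log 2 (m g x)" using pos[OF x] by simp
  then show ?thesis using mass_pos[OF x, of f] mass_pos[OF x, of g] by (simp add: log_def)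
qed

text \<open>The \<open>j\<close>-fibre of \<open>x\<close> lies in its \<open>f\<close>-fibre, and
  any further point would make the latter strictly heavier. So equal masses mean that, on this
  fibre, \<open>f\<close> determines \<open>j\<close>.\<close>

lemma value_eq_if_mass_eq:
  assumes eq: "m f x = m j x" and finer: "\<And>y. y \<in> \<Omega> \<Longrightarrow> j y = j x \<Longrightarrow> f y = f x"
    and z: "z \<in> \<Omega>" "f z = f x"
  shows "j z = j x"
proof (rule ccontr)
  assume "j z \<noteq> j x"
  then have "sum p {y \<in> \<Omega>. j y = j x} < sum p {y \<in> \<Omega>. f y = f x}"
    using z finer fin by (intro sum_strict_mono2[of _ _ z]) (auto intro: pos less_imp_le)
  then show False using eq by (simp add: mass_def)
qed

text \<open>The weights \<open>m f * m g / m c\<close> on the values of \<open>j\<close> have total at most 1, because \<open>f\<close> and \<open>g\<close> made conditionally independent given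
  \<open>c\<close> have total exactly 1 on a possibly larger set of pairs.\<close>

lemma sum_mass_ratio_le_1:
  assumes f: "\<And>x y. x \<in> \<Omega> \<Longrightarrow> y \<in> \<Omega> \<Longrightarrow> f y = f x \<Longrightarrow> c y = c x"
    and g: "\<And>x y. x \<in> \<Omega> \<Longrightarrow> y \<in> \<Omega> \<Longrightarrow> g y = g x \<Longrightarrow> c y = c x"
    and j: "\<And>x y. x \<in> \<Omega> \<Longrightarrow> y \<in> \<Omega> \<Longrightarrow> j y = j x \<longleftrightarrow> f y = f x \<and> g y = g x"
  shows "(\<Sum>x\<in>\<Omega>. p x * (m f x * m g x / (m j x * m c x))) \<le> 1"
proof -
  define q where "q x = p x / (m j x * m c x)" for x
  have split: "m k x = (\<Sum>y\<in>\<Omega>. if k y = k x then p y else 0)" for k :: "'a \<Rightarrow> 'k" and x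
    unfolding mass_def using fin by (rule sum.inter_filter)
  \<comment> \<open>The points that share \<open>f\<close> with \<open>y\<close> and
    \<open>g\<close> with \<open>z\<close> form one fibre of \<open>j\<close>, on which
    \<open>q\<close> adds up to \<open>1 / m c y\<close>, or there are none. The inequality is
    strict when \<open>c z = c y\<close> but the two values never occur together.\<close>
  have inner: "(\<Sum>x\<in>{x \<in> \<Omega>. f y = f x \<and> g z = g x}. q x) \<le> (if c z = c y then 1 / m c y else 0)"
    if y: "y \<in> \<Omega>" and z: "z \<in> \<Omega>" for y z
  proof (cases "{x \<in> \<Omega>. f y = f x \<and> g z = g x} = {}")
    case True
    show ?thesis unfolding True using mass_pos[OF y, of c] by simp
  next
    case False
    then obtain x where x: "x \<in> \<Omega>" "f y = f x" "g z = g x" by auto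
    have fib: "{t \<in> \<Omega>. f y = f t \<and> g z = g t} = {t \<in> \<Omega>. j t = j x}"
      using j[OF x(1)] x by auto
    have "m j t = m j x \<and> m c t = m c y" if "t \<in> \<Omega>" "j t = j x" for t
      using that j[OF x(1) that(1)] f[OF y that(1)] x by (auto intro!: mass_cong)
    then have "(\<Sum>t\<in>{t \<in> \<Omega>. f y = f t \<and> g z = g t}. q t) =
        (\<Sum>t\<in>{t \<in> \<Omega>. j t = j x}. p t / (m j x * m c y))"
      unfolding fib q_def by (intro sum.cong) auto
    also have "\<dots> = m j x / (m j x * m c y)"
      by (simp add: mass_def flip: sum_divide_distrib)
    also have "\<dots> = 1 / m c y" using mass_pos[OF x(1), of j] by simp
    finally show ?thesis using f[OF y x(1)] g[OF z x(1)] x by simp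
  qed
  have "(\<Sum>x\<in>\<Omega>. p x * (m f x * m g x / (m j x * m c x))) = (\<Sum>x\<in>\<Omega>. q x * (m f x * m g x))"
    by (simp add: q_def)
  \<comment> \<open>Both masses are expanded over separate sample points \<open>y\<close> and
    \<open>z\<close>; moving the sum over \<open>x\<close> innermost makes \<open>inner\<close>
    applicable to each pair.\<close>
  also have "\<dots> = (\<Sum>x\<in>\<Omega>. \<Sum>y\<in>\<Omega>. \<Sum>z\<in>\<Omega>. p y * p z * (if f y = f x \<and> g z = g x then q x else 0))"
  proof (rule sum.cong[OF refl])
    fix x
    show "q x * (m f x * m g x) =
        (\<Sum>y\<in>\<Omega>. \<Sum>z\<in>\<Omega>. p y * p z * (if f y = f x \<and> g z = g x then q x else 0))"
      unfolding split[of f] split[of g] sum_product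
      unfolding sum_distrib_left by (intro sum.cong refl) simp
  qed
  also have "\<dots> = (\<Sum>y\<in>\<Omega>. \<Sum>z\<in>\<Omega>. \<Sum>x\<in>\<Omega>. p y * p z * (if f y = f x \<and> g z = g x then q x else 0))"
    by (subst sum.swap, rule sum.cong[OF refl], rule sum.swap)
  also have "\<dots> = (\<Sum>y\<in>\<Omega>. \<Sum>z\<in>\<Omega>. p y * p z * (\<Sum>x\<in>{x \<in> \<Omega>. f y = f x \<and> g z = g x}. q x))"
    by (simp only: sum_distrib_left[symmetric] sum.inter_filter[OF fin])
  also have "\<dots> \<le> (\<Sum>y\<in>\<Omega>. \<Sum>z\<in>\<Omega>. p y * p z * (if c z = c y then 1 / m c y else 0))"
    by (intro sum_mono mult_left_mono inner) (auto intro!: mult_nonneg_nonneg less_imp_le[OF pos])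
  \<comment> \<open>The sum over \<open>z\<close> with \<open>c z = c y\<close> collapses to
    \<open>m c y\<close> and cancels the denominator.\<close>
  also have "\<dots> = (\<Sum>y\<in>\<Omega>. p y * (m c y / m c y))"
    unfolding split[of c] sum_divide_distrib sum_distrib_left
    by (intro sum.cong refl) simp
  also have "\<dots> = (\<Sum>y\<in>\<Omega>. p y)"
    using mass_pos[THEN less_imp_neq, of _ c] by (intro sum.cong refl) (metis divide_self mult.right_neutral)
  finally show ?thesis using total by simp
qed

text \<open>The hypothesis \<open>eq\<close> says that the conditional mutual information of
  \<open>f\<close> and \<open>g\<close> given \<open>c\<close> is zero; the conclusion is their
  conditional independence on the support.\<close>

lemma mass_modular_if_ent_modular:
  assumes f: "\<And>x y. x \<in> \<Omega> \<Longrightarrow> y \<in> \<Omega> \<Longrightarrow> f y = f x \<Longrightarrow> c y = c x"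
    and g: "\<And>x y. x \<in> \<Omega> \<Longrightarrow> y \<in> \<Omega> \<Longrightarrow> g y = g x \<Longrightarrow> c y = c x"
    and j: "\<And>x y. x \<in> \<Omega> \<Longrightarrow> y \<in> \<Omega> \<Longrightarrow> j y = j x \<longleftrightarrow> f y = f x \<and> g y = g x"
    and eq: "ent \<Omega> p f + ent \<Omega> p g = ent \<Omega> p j + ent \<Omega> p c" and x: "x \<in> \<Omega>"
  shows "m f x * m g x = m j x * m c x"
proof -
  \<comment> \<open>\<open>ln r \<le> r - 1\<close> holds termwise, so equality of the weighted sums forces \<open>r = 1\<close>.\<close>
  define r where "r x = m f x * m g x / (m j x * m c x)" for x
  have r: "0 < r y" if "y \<in> \<Omega>" for y
    using that by (simp add: r_def mass_pos)
  have "log 2 (r y) = log 2 (m f y) + log 2 (m g y) - log 2 (m j y) - log 2 (m c y)"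
    if "y \<in> \<Omega>" for y
    using mass_pos[OF that, of f] mass_pos[OF that, of g] mass_pos[OF that, of j]
      mass_pos[OF that, of c]
    by (simp add: r_def log_mult log_divide)
  then have "(\<Sum>y\<in>\<Omega>. p y * log 2 (r y)) =
      (\<Sum>y\<in>\<Omega>. p y * (log 2 (m f y) + log 2 (m g y) - log 2 (m j y) - log 2 (m c y)))"
    by simp
  also have "\<dots> = 0"
    using eq by (simp add: ent_def algebra_simps sum.distrib sum_subtractf)
  finally have "(\<Sum>y\<in>\<Omega>. p y * ln (r y)) = 0"
    by (simp add: log_def flip: sum_divide_distrib)
  moreover have "(\<Sum>y\<in>\<Omega>. p y * r y) \<le> 1"
    unfolding r_def by (rule sum_mass_ratio_le_1[OF f g j])
  ultimately have "(\<Sum>y\<in>\<Omega>. p y * (r y - 1 - ln (r y))) \<le> 0"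
    using total by (simp add: right_diff_distrib sum_subtractf)
  moreover have nn: "0 \<le> p y * (r y - 1 - ln (r y))" if "y \<in> \<Omega>" for y
    using ln_le_minus_one[OF r[OF that]] pos[OF that] by simp
  ultimately have "(\<Sum>y\<in>\<Omega>. p y * (r y - 1 - ln (r y))) = 0"
    by (intro antisym sum_nonneg) auto
  then have "p x * (r x - 1 - ln (r x)) = 0"
    using x nn fin by (simp add: sum_nonneg_eq_0_iff)
  then have "ln (r x) = r x - 1" using pos[OF x] by simp
  then have "r x = 1" using r[OF x] by (simp add: ln_eq_minus_one)
  then show ?thesis
    using mass_pos[OF x, of j] mass_pos[OF x, of c] by (simp add: r_def)
qed

section \<open>Independence and uniformity\<close>

lemma sum_by_values:
  assumes "A \<subseteq> \<Omega>"
  shows "sum p A = (\<Sum>v\<in>g ` A. sum p {x \<in> A. g x = v})"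
  using fin assms by (intro sum.group[symmetric]) (auto intro: finite_subset)

text \<open>By the product rule, the values of \<open>g\<close> reached on the
  \<open>f\<close>-fibre of \<open>x\<close> already carry total probability 1, so a value
  \<open>g y\<close> missing there would have mass 0.\<close>

lemma independent_imp_joint_value:
  assumes indep: "\<And>x. x \<in> \<Omega> \<Longrightarrow> m f x * m g x = m j x"
    and j: "\<And>x y. x \<in> \<Omega> \<Longrightarrow> y \<in> \<Omega> \<Longrightarrow> j y = j x \<longleftrightarrow> f y = f x \<and> g y = g x"
    and x: "x \<in> \<Omega>" and y: "y \<in> \<Omega>"
  shows "\<exists>z\<in>\<Omega>. f z = f x \<and> g z = g y"
proof (rule ccontr)
  assume no: "\<not> ?thesis"
  define A where "A = {z \<in> \<Omega>. f z = f x}"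
  define W where "W v = sum p {z \<in> \<Omega>. g z = v}" for v
  have joint: "sum p {z \<in> A. g z = v} = m f x * W v" if v: "v \<in> g ` A" for v
  proof -
    obtain t where t: "t \<in> \<Omega>" "f t = f x" "v = g t" using v by (auto simp: A_def)
    have "{z \<in> A. g z = v} = {z \<in> \<Omega>. j z = j t}"
      using j[OF t(1)] t by (auto simp: A_def)
    then have "sum p {z \<in> A. g z = v} = m j t" by (simp add: mass_def)
    also have "\<dots> = m f x * W v"
      using indep[OF t(1)] t by (simp add: mass_def W_def)
    finally show ?thesis .
  qed
  have "m f x = sum p A" by (simp add: mass_def A_def)
  also have "\<dots> = (\<Sum>v\<in>g ` A. sum p {z \<in> A. g z = v})"
    by (rule sum_by_values) (auto simp: A_def)
  also have "\<dots> = m f x * sum W (g ` A)"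
    using joint by (simp add: sum_distrib_left)
  finally have 1: "sum W (g ` A) = 1" using mass_pos[OF x, of f] by simp
  have "1 = sum W (g ` \<Omega>)"
    using sum_by_values[of \<Omega> g] total by (simp add: W_def)
  also have "\<dots> \<ge> sum W (insert (g y) (g ` A))"
    using fin y by (intro sum_mono2) (auto simp: A_def W_def intro!: sum_nonneg less_imp_le[OF pos])
  also have "sum W (insert (g y) (g ` A)) = W (g y) + 1"
    using no fin 1 by (subst sum.insert) (auto simp: A_def)
  finally have "W (g y) \<le> 0" by simp
  then show False using mass_pos[OF y, of g] by (simp add: mass_def W_def)
qed

text \<open>The values share the total mass 1 equally, so each has mass \<open>1 / n\<close>. The
  integer under the logarithm is the number of values.\<close>

lemma ent_uniform:
  assumes "\<And>x y. x \<in> \<Omega> \<Longrightarrow> y \<in> \<Omega> \<Longrightarrow> m f x = m f y"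
  shows "ent \<Omega> p f = log 2 (card (f ` \<Omega>)) \<and> 1 \<le> card (f ` \<Omega>)"
proof -
  define n where "n = card (f ` \<Omega>)"
  have "\<Omega> \<noteq> {}" using total by auto
  then obtain x where x: "x \<in> \<Omega>" by blast
  have n: "0 < n" unfolding n_def using fin \<open>\<Omega> \<noteq> {}\<close> by (simp add: card_gt_0_iff)
  have "1 = (\<Sum>v\<in>f ` \<Omega>. sum p {z \<in> \<Omega>. f z = v})"
    using sum_by_values[of \<Omega> f] total by simp
  also have "\<dots> = (\<Sum>v\<in>f ` \<Omega>. m f x)"
    using assms[OF _ x] by (intro sum.cong) (auto simp: mass_def)
  finally have "m f x = 1 / n" using n by (simp add: n_def field_simps)
  then have "m f y = 1 / n" if "y \<in> \<Omega>" for y using assms[OF that x] by simp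
  then have "ent \<Omega> p f = - (\<Sum>y\<in>\<Omega>. p y * log 2 (1 / n))" by (simp add: ent_def)
  also have "\<dots> = log 2 n"
    using total n by (simp add: log_divide sum_negf flip: sum_distrib_right)
  finally show ?thesis using n by (simp add: n_def)
qed

lemma prob_space_point_measure: "prob_space (point_measure \<Omega> p)"
  using fin pos total
  by (intro prob_space_point_measure) (simp_all add: less_imp_le sum_ennreal)

end

section \<open>From random variables on a probability space to weighted points\<close>

text \<open>A fibre of \<open>Z\<close> is a finite disjoint union of fibres of \<open>S\<close>.
  Values of \<open>S\<close> of probability 0 add nothing, and leaving them out of
  \<open>\<Omega>\<close> makes all weights positive.\<close>

lemma measure_fibre_eq_sum:
  fixes M :: "'w measure" and S :: "'w \<Rightarrow> 's" and Z :: "'w \<Rightarrow> 'z"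
  assumes P: "prob_space M" and S: "simple_function M S"
    and ZS: "\<And>w. w \<in> space M \<Longrightarrow> Z w = \<phi> (S w)"
  defines "p \<equiv> \<lambda>s. measure M (S -` {s} \<inter> space M)"
  defines "\<Omega> \<equiv> {s \<in> S ` space M. 0 < p s}"
  shows "measure M (Z -` {z} \<inter> space M) = sum p {s \<in> \<Omega>. \<phi> s = z}"
proof -
  interpret prob_space M by (rule P)
  have finS: "finite (S ` space M)" using S by (simp add: simple_function_def)
  have "Z -` {z} \<inter> space M = (\<Union>s\<in>{s \<in> S ` space M. \<phi> s = z}. S -` {s} \<inter> space M)"
    using ZS by auto
  then have "measure M (Z -` {z} \<inter> space M) = sum p {s \<in> S ` space M. \<phi> s = z}"
    unfolding p_def using finS simple_functionD(2)[OF S]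
    by (simp only:) (rule finite_measure_finite_Union, auto simp: disjoint_family_on_def)
  also have "\<dots> = sum p {s \<in> \<Omega>. \<phi> s = z}"
    using finS by (intro sum.mono_neutral_right) (auto simp: \<Omega>_def p_def zero_less_measure_iff)
  finally show ?thesis .
qed

lemma positive_weights_law:
  fixes M :: "'w measure" and S :: "'w \<Rightarrow> 's"
  assumes P: "prob_space M" and S: "simple_function M S"
  defines "p \<equiv> \<lambda>s. measure M (S -` {s} \<inter> space M)"
  shows "positive_weights {s \<in> S ` space M. 0 < p s} p"
proof
  show "finite {s \<in> S ` space M. 0 < p s}" using S by (simp add: simple_function_def)
  show "sum p {s \<in> S ` space M. 0 < p s} = 1"
    \<comment> \<open>For constant maps the only fibre is the whole space.\<close>
    using measure_fibre_eq_sum[OF P S, of "\<lambda>_. ()" "\<lambda>_. ()" "()"] prob_space.prob_space[OF P]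
    by (simp add: p_def)
qed simp

text \<open>Group the points by the value of \<open>Z\<close>. A value of probability 0 has no
  points in \<open>\<Omega>\<close> and contributes 0 on both sides.\<close>

lemma entropy_eq_ent:
  fixes M :: "'w measure" and S :: "'w \<Rightarrow> 's" and Z :: "'w \<Rightarrow> 'z"
  assumes P: "prob_space M" and S: "simple_function M S" and Z: "simple_function M Z"
    and ZS: "\<And>w. w \<in> space M \<Longrightarrow> Z w = \<phi> (S w)"
  defines "p \<equiv> \<lambda>s. measure M (S -` {s} \<inter> space M)"
  defines "\<Omega> \<equiv> {s \<in> S ` space M. 0 < p s}"
  shows "prob_space.entropy M 2 (count_space (Z ` space M)) Z = ent \<Omega> p \<phi>"
proof -
  have fin: "finite \<Omega>" and finZ: "finite (Z ` space M)"
    using S Z by (auto simp: simple_function_def \<Omega>_def)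
  have fib: "measure M (Z -` {z} \<inter> space M) = sum p {s \<in> \<Omega>. \<phi> s = z}" for z
    unfolding \<Omega>_def p_def by (rule measure_fibre_eq_sum[where \<phi> = \<phi>, OF P S ZS])
  have "ent \<Omega> p \<phi> = - (\<Sum>s\<in>\<Omega>. p s * log 2 (sum p {t \<in> \<Omega>. \<phi> t = \<phi> s}))"
    by (simp add: ent_def mass_def)
  also have "(\<Sum>s\<in>\<Omega>. p s * log 2 (sum p {t \<in> \<Omega>. \<phi> t = \<phi> s})) =
      (\<Sum>z\<in>Z ` space M. \<Sum>s\<in>{s \<in> \<Omega>. \<phi> s = z}. p s * log 2 (sum p {t \<in> \<Omega>. \<phi> t = \<phi> s}))"
    using ZS by (intro sum.group[symmetric] fin finZ) (force simp: \<Omega>_def)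
  also have "\<dots> = (\<Sum>z\<in>Z ` space M. sum p {s \<in> \<Omega>. \<phi> s = z} * log 2 (sum p {s \<in> \<Omega>. \<phi> s = z}))"
    by (simp add: sum_distrib_right)
  finally show ?thesis
    unfolding entropy_simple[OF P Z] fib by simp
qed

lemma (in positive_weights) entropy_point_measure:
  "prob_space.entropy (point_measure \<Omega> p) 2 (count_space (Z ` \<Omega>)) Z = ent \<Omega> p Z"
proof -
  define P where "P = point_measure \<Omega> (\<lambda>x. ennreal (p x))"
  have sf: "simple_function P g" for g :: "'a \<Rightarrow> 'g"
    unfolding P_def using fin by simp
  have sp: "space P = \<Omega>" by (simp add: P_def space_point_measure)
  have meas: "measure P ((\<lambda>x. x) -` {x} \<inter> space P) = p x" if "x \<in> \<Omega>" for x
  proof -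
    have "(\<lambda>x. x) -` {x} \<inter> space P = {x}" using that sp by auto
    then show ?thesis
      using that fin pos[OF that] by (simp add: P_def measure_def emeasure_point_measure_finite less_imp_le)
  qed
  have "{s \<in> (\<lambda>x. x) ` space P. 0 < measure P ((\<lambda>x. x) -` {s} \<inter> space P)} = \<Omega>"
    using meas pos by (auto simp: sp)
  \<comment> \<open>The identity plays the role of \<open>S\<close>; its law is \<open>p\<close>
    itself.\<close>
  then have "prob_space.entropy P 2 (count_space (Z ` space P)) Z =
      ent \<Omega> (\<lambda>s. measure P ((\<lambda>x. x) -` {s} \<inter> space P)) Z"
    using entropy_eq_ent[of P "\<lambda>x. x" Z Z, OF _ sf sf] prob_space_point_measure
    by (simp only: P_def simp_thms)
  also have "\<dots> = ent \<Omega> p Z"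
    using meas by (auto simp: ent_def mass_def intro!: sum.cong arg_cong[where f = "log 2"])
  finally show ?thesis by (simp only: sp flip: P_def)
qed

section \<open>Distributions of prescribed entropy\<close>

lemma continuous_on_mult_log: "continuous_on {0..} (\<lambda>x::real. x * log 2 x)"
  unfolding continuous_on_eq_continuous_within
proof
  fix x :: real assume "x \<in> {0..}"
  then consider "x = 0" | "0 < x" by force
  then show "continuous (at x within {0..}) (\<lambda>x. x * log 2 x)"
  proof cases
    case 1
    have "((\<lambda>x::real. x * log 2 x) \<longlongrightarrow> 0) (at_right 0)" by real_asymp
    then show ?thesis
      using 1 by (simp add: continuous_within at_within_Ici_at_right)
  next
    case 2
    then have "isCont (\<lambda>x. x * log 2 x) x" by (auto intro!: continuous_intros)
    then show ?thesis by (rule continuous_at_imp_continuous_at_within)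
  qed
qed

text \<open>Interpolate linearly between a point mass, of entropy 0, and a uniform distribution of
  entropy at least \<open>b\<close>; the intermediate value theorem then gives entropy exactly
  \<open>b\<close>.\<close>

lemma exists_weights_with_entropy:
  fixes b :: real
  assumes "0 \<le> b"
  obtains S :: "nat set" and q where "positive_weights S q" "- (\<Sum>s\<in>S. q s * log 2 (q s)) = b"
proof -
  define n :: nat where "n = 2 ^ nat \<lceil>b\<rceil>"
  have n: "0 < n" by (simp add: n_def)
  have "log 2 n = real (nat \<lceil>b\<rceil>)" by (simp add: n_def log_nat_power)
  then have bn: "b \<le> log 2 n" using real_nat_ceiling_ge by simp
  define q where "q t i = (if i = 0 then 1 - t else 0) + t / n" for t :: real and i :: nat
  define g where "g t = - (\<Sum>i<n. q t i * log 2 (q t i))" for t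
  have q0: "0 \<le> q t i" if "t \<in> {0..1}" for t i
    using that n by (auto simp: q_def intro!: add_nonneg_nonneg)
  have "continuous_on {0..1} (\<lambda>t. q t i * log 2 (q t i))" for i
  proof (rule continuous_on_compose2[OF continuous_on_mult_log, where f = "\<lambda>t. q t i"])
    show "continuous_on {0..1} (\<lambda>t. q t i)"
      using n by (cases "i = 0") (auto simp: q_def intro!: continuous_intros)
  qed (use q0 in auto)
  then have "continuous_on {0..1} g"
    unfolding g_def by (intro continuous_on_minus continuous_on_sum)
  moreover have "q 0 i * log 2 (q 0 i) = 0" for i by (simp add: q_def)
  then have "g 0 = 0" unfolding g_def by (simp only: sum.neutral_const minus_zero)
  moreover have "g 1 = log 2 n"
  proof -
    have "q 1 i = 1 / n" for i by (simp add: q_def)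
    then show ?thesis using n by (simp add: g_def log_divide)
  qed
  ultimately obtain t where t: "0 \<le> t" "t \<le> 1" "g t = b"
    using IVT'[of g 0 b 1] assms bn by auto
  \<comment> \<open>Points of weight 0 are discarded to obtain positive weights; the entropy is
    unchanged since their terms are 0.\<close>
  define S where "S = {i. i < n \<and> 0 < q t i}"
  have S: "S \<subseteq> {..<n}" "\<And>i. i \<in> {..<n} - S \<Longrightarrow> q t i = 0"
    using q0[of t] t by (auto simp: S_def intro: antisym)
  have restr: "sum f S = sum f {..<n}" if "\<And>i. q t i = 0 \<Longrightarrow> f i = 0" for f :: "nat \<Rightarrow> real"
    using S that by (intro sum.mono_neutral_left) auto
  have "positive_weights S (q t)"
  proof
    show "sum (q t) S = 1"
      using n by (subst restr) (auto simp: q_def sum.distrib)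
  qed (auto simp: S_def)
  moreover have "- (\<Sum>s\<in>S. q t s * log 2 (q t s)) = b"
    using t(3) by (subst restr) (auto simp: g_def)
  ultimately show thesis by (rule that)
qed

section \<open>Construction of a random vector when \<open>a\<close> is the logarithm of an
  integer\<close>

text \<open>For \<open>u < v\<close> the natural number \<open>v - u\<close> represents the inverse
  of \<open>u\<close> modulo \<open>v\<close>, so the right side is subtraction of \<open>u\<close>
  from \<open>c\<close>.\<close>

lemma add_mod_eq_iff:
  fixes u w v c :: nat
  assumes "u < v" "w < v"
  shows "(u + w) mod v = c mod v \<longleftrightarrow> w = (c + (v - u)) mod v"
proof
  assume eq: "(u + w) mod v = c mod v"
  have "(c + (v - u)) mod v = ((u + w) mod v + (v - u)) mod v" by (simp add: eq mod_add_left_eq)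
  also have "\<dots> = ((u + w) + (v - u)) mod v" by (rule mod_add_left_eq)
  also have "(u + w) + (v - u) = w + v" using assms by simp
  finally show "w = (c + (v - u)) mod v" using assms by simp
next
  assume "w = (c + (v - u)) mod v"
  then have "(u + w) mod v = (u + (c + (v - u))) mod v" by (simp add: mod_add_right_eq)
  also have "u + (c + (v - u)) = c + v" using assms by simp
  finally show "(u + w) mod v = c mod v" by simp
qed

lemma entropic_pair_point_log:
  fixes v :: nat
  assumes v: "1 \<le> v" and b: "0 \<le> b"
  shows "entropic (pair_point (uniform_rank 2 {1, 2, 3}) (uniform_rank 1 {1, 2, 4}) (log 2 v) b)"
proof -
  define h where "h = pair_point (uniform_rank 2 {1, 2, 3}) (uniform_rank 1 {1, 2, 4}) (log 2 v) b"
  obtain S :: "nat set" and q where S: "positive_weights S q"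
    and Hq: "- (\<Sum>s\<in>S. q s * log 2 (q s)) = b"
    using exists_weights_with_entropy[OF b] .
  interpret S: positive_weights S q by (rule S)
  define \<Omega> where "\<Omega> = {..<v} \<times> {..<v} \<times> S"
  \<comment> \<open>The factor \<open>1 / v\<^sup>2\<close> makes \<open>u\<close> and
    \<open>w\<close> uniform and independent of each other and of \<open>z\<close>. Below, a zero
    second component merely pads \<open>X 3\<close> and \<open>X 4\<close> to pairs.\<close>
  define p where "p = (\<lambda>(u::nat, w::nat, z). q z / v\<^sup>2)"
  define X :: "nat \<Rightarrow> nat \<times> nat \<times> nat \<Rightarrow> nat \<times> nat" where
    "X j = (\<lambda>(u, w, z). if j = 1 then (u, z) else if j = 2 then (w, z)
      else if j = 3 then ((u + w) mod v, 0) else (z, 0))" for j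
  have sum_box: "(\<Sum>x\<in>U \<times> W \<times> Z. case x of (u, w, z) \<Rightarrow> F z / v\<^sup>2) =
      card U * card W * sum F Z / v\<^sup>2"
    for F :: "nat \<Rightarrow> real" and U W Z :: "nat set"
    by (simp add: sum.cartesian_product[symmetric] flip: sum_divide_distrib)
  have sum_\<Omega>: "(\<Sum>x\<in>\<Omega>. case x of (u, w, z) \<Rightarrow> F z / v\<^sup>2) = sum F S" for F :: "nat \<Rightarrow> real"
    using v unfolding \<Omega>_def sum_box by (simp add: power2_eq_square)
  interpret positive_weights \<Omega> p
  proof
    show "finite \<Omega>" by (simp add: \<Omega>_def S.fin)
    show "0 < p x" if "x \<in> \<Omega>" for x using that v S.pos by (auto simp: \<Omega>_def p_def)
    show "sum p \<Omega> = 1" using sum_\<Omega>[of q] S.total by (simp add: p_def)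
  qed
  have val: "subvector X A y = subvector X A x \<longleftrightarrow> (\<forall>j\<in>A. X j y = X j x)" for A x y
    by (auto simp: subvector_def restrict_def fun_eq_iff)
  \<comment> \<open>If every fibre has mass \<open>q z ^ k / v ^ l\<close>, the entropy follows; the
    blocks below only identify fibres. Here \<open>k\<close> tells whether \<open>z\<close> is
    determined, and \<open>l\<close> counts the independent uniform symbols that are.\<close>
  have ent: "ent \<Omega> p (subvector X A) = l * log 2 v + k * b"
    if A: "\<And>u w z. (u, w, z) \<in> \<Omega> \<Longrightarrow> sum p {y \<in> \<Omega>. \<forall>j\<in>A. X j y = X j (u, w, z)} = q z ^ k / v ^ l"
    for A and k l :: nat
  proof -
    have "p x * log 2 (m (subvector X A) x) =
        (case x of (u, w, z) \<Rightarrow> q z * (k * log 2 (q z) - l * log 2 v) / v\<^sup>2)" if x: "x \<in> \<Omega>" for x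
    proof -
      obtain u w z where xe: "x = (u, w, z)" by (cases x)
      have "0 < q z" using x xe S.pos by (simp add: \<Omega>_def)
      moreover have "m (subvector X A) x = q z ^ k / v ^ l"
        using A x xe by (simp add: mass_def val)
      ultimately show ?thesis
        using v by (simp add: xe p_def log_divide log_nat_power)
    qed
    then have "ent \<Omega> p (subvector X A) =
        - (\<Sum>x\<in>\<Omega>. case x of (u, w, z) \<Rightarrow> q z * (k * log 2 (q z) - l * log 2 v) / v\<^sup>2)"
      by (simp add: ent_def)
    also have "\<dots> = - (\<Sum>z\<in>S. q z * (k * log 2 (q z) - l * log 2 v))"
      by (simp only: sum_\<Omega>)
    also have "\<dots> = l * log 2 v * sum q S + k * (- (\<Sum>z\<in>S. q z * log 2 (q z)))"
      by (simp add: algebra_simps sum_subtractf sum_distrib_left sum_distrib_right)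
    finally show ?thesis by (simp add: S.total Hq)
  qed
  \<comment> \<open>the second summand that gives \<open>u\<close> the sum \<open>c\<close> modulo \<open>v\<close>\<close>
  define w' where "w' c u = (c + (v - u)) mod v" for c u
  have w': "w < v \<and> (u + w) mod v = c mod v \<longleftrightarrow> w = w' c u" if "u < v" for u w c
    using add_mod_eq_iff[OF that, of w c] v by (auto simp: w'_def)
  have inj: "w1 = w2" if "(u + w1) mod v = (u + w2) mod v" "u < v" "w1 < v" "w2 < v" for u w1 w2
    using w'[OF that(2), of w1 "u + w2"] w'[OF that(2), of w2 "u + w2"] that(1,3,4) by metis
  have inj': "w1 = w2" if "(w1 + u) mod v = (w2 + u) mod v" "u < v" "w1 < v" "w2 < v" for u w1 w2
    using inj[of u w1 w2] that unfolding add.commute[of _ u] by blast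
  have fibre: "sum p {y \<in> \<Omega>. \<forall>j\<in>A. X j y = X j (u, w, z)} = sum p B"
    if "\<And>u' w' z'. (u', w', z') \<in> \<Omega> \<and> (\<forall>j\<in>A. X j (u', w', z') = X j (u, w, z))
      \<longleftrightarrow> (u', w', z') \<in> B" for A B u w z
  proof (rule arg_cong[where f = "sum p"], rule set_eqI)
    show "y \<in> {y \<in> \<Omega>. \<forall>j\<in>A. X j y = X j (u, w, z)} \<longleftrightarrow> y \<in> B" for y
      using that[of "fst y" "fst (snd y)" "snd (snd y)"] by simp
  qed
  have H0: "ent \<Omega> p (subvector X {}) = 0"
    using ent[of "{}" 0 0] total by simp
  \<comment> \<open>\<open>X 1\<close> fixes \<open>u\<close> and \<open>z\<close> and leaves
    \<open>w\<close> free; \<open>X 4\<close> adds nothing. The case of \<open>X 2\<close> is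
    symmetric.\<close>
  have H1: "ent \<Omega> p (subvector X A) = log 2 v + b" if A: "A \<in> {{1}, {1, 4}}" for A
  proof -
    have "sum p {y \<in> \<Omega>. \<forall>j\<in>A. X j y = X j (u, w, z)} = q z ^ 1 / v ^ 1"
      if "(u, w, z) \<in> \<Omega>" for u w z
    proof -
      have "sum p {y \<in> \<Omega>. \<forall>j\<in>A. X j y = X j (u, w, z)} = sum p ({u} \<times> {..<v} \<times> {z})"
        using A that
        by - (rule fibre, elim insertE emptyE, simp_all add: X_def \<Omega>_def, auto)
      then show ?thesis using v unfolding p_def sum_box by (simp add: power2_eq_square)
    qed
    from ent[OF this] show ?thesis by simp
  qed
  have H2: "ent \<Omega> p (subvector X A) = log 2 v + b" if A: "A \<in> {{2}, {2, 4}}" for A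
  proof -
    have "sum p {y \<in> \<Omega>. \<forall>j\<in>A. X j y = X j (u, w, z)} = q z ^ 1 / v ^ 1"
      if "(u, w, z) \<in> \<Omega>" for u w z
    proof -
      have "sum p {y \<in> \<Omega>. \<forall>j\<in>A. X j y = X j (u, w, z)} = sum p ({..<v} \<times> {w} \<times> {z})"
        using A that
        by - (rule fibre, elim insertE emptyE, simp_all add: X_def \<Omega>_def, auto)
      then show ?thesis using v unfolding p_def sum_box by (simp add: power2_eq_square)
    qed
    from ent[OF this] show ?thesis by simp
  qed
  have H3: "ent \<Omega> p (subvector X {3}) = log 2 v"
  proof -
    have "sum p {y \<in> \<Omega>. \<forall>j\<in>{3}. X j y = X j (u, w, z)} = q z ^ 0 / v ^ 1"
      if "(u, w, z) \<in> \<Omega>" for u w z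
    proof -
      \<comment> \<open>With the sum fixed, \<open>u\<close> and \<open>z\<close> are free and
        \<open>w\<close> is forced, so the fibre is a graph over the pairs of \<open>u\<close> and
        \<open>z\<close>.\<close>
      have "sum p {y \<in> \<Omega>. \<forall>j\<in>{3}. X j y = X j (u, w, z)} =
          sum p ((\<lambda>(u', z'). (u', w' (u + w) u', z')) ` ({..<v} \<times> S))"
      proof (rule fibre)
        fix u1 w1 z1
        have "(u1, w1, z1) \<in> (\<lambda>(u', z'). (u', w' (u + w) u', z')) ` ({..<v} \<times> S) \<longleftrightarrow>
            u1 < v \<and> w1 = w' (u + w) u1 \<and> z1 \<in> S"
          by auto
        then show "(u1, w1, z1) \<in> \<Omega> \<and> (\<forall>j\<in>{3}. X j (u1, w1, z1) = X j (u, w, z)) \<longleftrightarrow>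
            (u1, w1, z1) \<in> (\<lambda>(u', z'). (u', w' (u + w) u', z')) ` ({..<v} \<times> S)"
          using w'[of u1 w1 "u + w"] that by (auto simp: X_def \<Omega>_def)
      qed
      also have "\<dots> = (\<Sum>(u', z')\<in>{..<v} \<times> S. q z' / v\<^sup>2)"
        by (subst sum.reindex) (auto simp: inj_on_def p_def intro!: sum.cong)
      finally show ?thesis
        using v S.total
        by (simp add: sum.cartesian_product[symmetric] power2_eq_square flip: sum_divide_distrib)
    qed
    from ent[OF this] show ?thesis by simp
  qed
  have H4: "ent \<Omega> p (subvector X {4}) = b"
  proof -
    have "sum p {y \<in> \<Omega>. \<forall>j\<in>{4}. X j y = X j (u, w, z)} = q z ^ 1 / v ^ 0"
      if "(u, w, z) \<in> \<Omega>" for u w z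
    proof -
      have "sum p {y \<in> \<Omega>. \<forall>j\<in>{4}. X j y = X j (u, w, z)} = sum p ({..<v} \<times> {..<v} \<times> {z})"
        using that by - (rule fibre, simp add: X_def \<Omega>_def, auto)
      then show ?thesis using v unfolding p_def sum_box by (simp add: power2_eq_square)
    qed
    from ent[OF this] show ?thesis by simp
  qed
  have H34: "ent \<Omega> p (subvector X {3, 4}) = log 2 v + b"
  proof -
    have "sum p {y \<in> \<Omega>. \<forall>j\<in>{3, 4}. X j y = X j (u, w, z)} = q z ^ 1 / v ^ 1"
      if "(u, w, z) \<in> \<Omega>" for u w z
    proof -
      have "sum p {y \<in> \<Omega>. \<forall>j\<in>{3, 4}. X j y = X j (u, w, z)} =
          sum p ((\<lambda>u'. (u', w' (u + w) u', z)) ` {..<v})"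
      proof (rule fibre)
        fix u1 w1 z1
        have "(u1, w1, z1) \<in> (\<lambda>u'. (u', w' (u + w) u', z)) ` {..<v} \<longleftrightarrow>
            u1 < v \<and> w1 = w' (u + w) u1 \<and> z1 = z"
          by auto
        then show "(u1, w1, z1) \<in> \<Omega> \<and> (\<forall>j\<in>{3, 4}. X j (u1, w1, z1) = X j (u, w, z)) \<longleftrightarrow>
            (u1, w1, z1) \<in> (\<lambda>u'. (u', w' (u + w) u', z)) ` {..<v}"
          using w'[of u1 w1 "u + w"] that by (auto simp: X_def \<Omega>_def)
      qed
      also have "\<dots> = (\<Sum>u'<v. q z / v\<^sup>2)"
        by (subst sum.reindex) (auto simp: inj_on_def p_def)
      finally show ?thesis using v by (simp add: power2_eq_square)
    qed
    from ent[OF this] show ?thesis by simp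
  qed
  \<comment> \<open>Any two of \<open>u\<close>, \<open>w\<close> and their sum modulo
    \<open>v\<close> determine the third, and \<open>X 1\<close> or \<open>X 2\<close> supplies
    \<open>z\<close>: the fibres are single points.\<close>
  have Hall: "ent \<Omega> p (subvector X A) = 2 * log 2 v + b"
    if A: "{1, 2} \<subseteq> A \<or> {1, 3} \<subseteq> A \<or> {2, 3} \<subseteq> A" for A
  proof -
    have "sum p {y \<in> \<Omega>. \<forall>j\<in>A. X j y = X j (u, w, z)} = sum p {(u, w, z)}"
      if "(u, w, z) \<in> \<Omega>" for u w z
    proof (rule fibre)
      fix u' w'' z'
      show "(u', w'', z') \<in> \<Omega> \<and> (\<forall>j\<in>A. X j (u', w'', z') = X j (u, w, z))
        \<longleftrightarrow> (u', w'', z') \<in> {(u, w, z)}"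
      proof
        assume *: "(u', w'', z') \<in> \<Omega> \<and> (\<forall>j\<in>A. X j (u', w'', z') = X j (u, w, z))"
        have "1 \<in> A \<Longrightarrow> u' = u \<and> z' = z" "2 \<in> A \<Longrightarrow> w'' = w \<and> z' = z"
          "3 \<in> A \<Longrightarrow> (u' + w'') mod v = (u + w) mod v"
          using * by (auto simp: X_def dest!: bspec)
        then show "(u', w'', z') \<in> {(u, w, z)}"
          using A * that inj[of u w'' w] inj'[of u' w u] by (auto simp: \<Omega>_def)
      qed (use that in auto)
    qed
    then have "sum p {y \<in> \<Omega>. \<forall>j\<in>A. X j y = X j (u, w, z)} = q z ^ 1 / v ^ 2"
      if "(u, w, z) \<in> \<Omega>" for u w z
      using that by (simp add: p_def)
    from ent[OF this] show ?thesis by simp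
  qed
  have hA: "h A = ent \<Omega> p (subvector X A)" if "A \<subseteq> N4" for A
    using subset_N4_cases[OF that] unfolding insert_iff empty_iff
    by (elim disjE FalseE)
      (simp_all add: h_def pair_point_expand H0 H1 H2 H3 H4 H34 Hall del: One_nat_def)
  have "entropy_represents (point_measure \<Omega> p) X h"
    unfolding entropy_represents_def
    using prob_space_point_measure fin
    by (simp add: hA entropy_point_measure space_point_measure)
  then show ?thesis unfolding h_def by (rule entropicI)
qed

section \<open>Necessity: an entropic point has \<open>a\<close> equal to the logarithm of an
  integer\<close>

lemma entropic_pair_point_imp_log:
  assumes "entropic (pair_point (uniform_rank 2 {1, 2, 3}) (uniform_rank 1 {1, 2, 4}) a b)"
  shows "\<exists>v::nat. 1 \<le> v \<and> a = log 2 (real v)"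
proof -
  define h where "h = pair_point (uniform_rank 2 {1, 2, 3}) (uniform_rank 1 {1, 2, 4}) a b"
  obtain M :: "nat measure" and X :: "nat \<Rightarrow> nat \<Rightarrow> nat" where "entropy_represents M X h"
    using assms unfolding entropic_def h_def by blast
  then have P: "prob_space M" and X: "\<forall>i\<in>N4. simple_function M (X i)"
    and h: "\<And>A. A \<subseteq> N4 \<Longrightarrow>
      h A = prob_space.entropy M 2 (count_space (subvector X A ` space M)) (subvector X A)"
    by (auto simp: entropy_represents_def)
  define S where "S = subvector X N4"
  define p where "p s = measure M (S -` {s} \<inter> space M)" for s
  \<comment> \<open>The sample space becomes the support of the joint law, and each subvector a
    coordinate restriction \<open>e A\<close>.\<close>
  define \<Omega> where "\<Omega> = {s \<in> S ` space M. 0 < p s}"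
  have sS: "simple_function M S"
    unfolding S_def by (rule simple_function_subvector[OF X]) simp
  interpret positive_weights \<Omega> p
    using positive_weights_law[OF P sS] unfolding \<Omega>_def p_def .
  define e :: "nat set \<Rightarrow> (nat \<Rightarrow> nat) \<Rightarrow> nat \<Rightarrow> nat" where "e A s = restrict s A" for A s
  have ent: "ent \<Omega> p (e A) = h A" if A: "A \<subseteq> N4" for A
  proof -
    have "subvector X A w = e A (S w)" for w
      using A by (auto simp: e_def S_def subvector_def restrict_def fun_eq_iff)
    then show ?thesis
      using h[OF A] entropy_eq_ent[OF P sS simple_function_subvector[OF X A], of "e A"]
      unfolding \<Omega>_def p_def by simp
  qed
  have e_iff: "e A y = e A x \<longleftrightarrow> (\<forall>j\<in>A. y j = x j)" for A x y
    by (auto simp: e_def restrict_def fun_eq_iff)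
  have mass_eq: "m (e A) x = m (e B) x"
    if "A \<subseteq> B" "B \<subseteq> N4" "h A = h B" "x \<in> \<Omega>" for A B x
    using that by (intro mass_eq_if_ent_eq) (auto simp: ent e_iff)
  have modular: "m (e A) x * m (e B) x = m (e D) x * m (e C) x"
    if "A \<subseteq> N4" "B \<subseteq> N4" "C \<subseteq> A \<inter> B" "D = A \<union> B" "h A + h B = h D + h C" "x \<in> \<Omega>"
    for A B C D x
    using that by (intro mass_modular_if_ent_modular) (auto simp: ent e_iff subset_iff)
  have m_empty: "m (e {}) x = 1" for x
    using total by (simp add: mass_def e_iff)
  note hval = pair_point_expand[of a b, folded h_def]
  have m13: "m (e {1}) x * m (e {3}) x = m (e {1, 3}) x" if "x \<in> \<Omega>" for x
  proof -
    have "m (e {1}) x * m (e {3}) x = m (e {1, 3}) x * m (e {}) x"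
      by (rule modular) (use that hval in \<open>auto simp: N4_def\<close>)
    then show ?thesis by (simp add: m_empty)
  qed
  have key: "m (e {1}) x = m (e {3}) x * m (e {4}) x" if x: "x \<in> \<Omega>" for x
  proof -
    \<comment> \<open>\<open>{1, 2, 4}\<close> and \<open>{2, 3}\<close> both have full rank
      \<open>2*a + b\<close>, hence equal masses; this links the two modular equalities below, after
      which \<open>m (e {2}) x\<close> cancels.\<close>
    have "m (e {1}) x = m (e {1, 4}) x" "m (e {2}) x = m (e {2, 4}) x"
      "m (e {2, 3}) x = m (e {1, 2, 3, 4}) x" "m (e {1, 2, 4}) x = m (e {1, 2, 3, 4}) x"
      by (rule mass_eq; use x hval in \<open>auto simp: N4_def\<close>)+
    moreover have "m (e {1, 4}) x * m (e {2, 4}) x = m (e {1, 2, 4}) x * m (e {4}) x"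
      by (rule modular) (use x hval in \<open>auto simp: N4_def\<close>)
    moreover have "m (e {2}) x * m (e {3}) x = m (e {2, 3}) x * m (e {}) x"
      by (rule modular) (use x hval in \<open>auto simp: N4_def\<close>)
    ultimately have "m (e {2}) x * m (e {1}) x = m (e {2}) x * (m (e {3}) x * m (e {4}) x)"
      by (simp add: m_empty mult_ac)
    then show ?thesis using mass_pos[OF x, of "e {2}"] by simp
  qed
  have "m (e {3}) x = m (e {3}) y" if x: "x \<in> \<Omega>" and y: "y \<in> \<Omega>" for x y
  proof -
    \<comment> \<open>\<open>z\<close> combines the first coordinate of \<open>x\<close> with the
      third of \<open>y\<close>. As the first coordinate determines the fourth, \<open>key\<close>
      at \<open>x\<close> and at \<open>z\<close> differs only in the mass of the third.\<close>
    obtain z where z: "z \<in> \<Omega>" "e {1} z = e {1} x" "e {3} z = e {3} y"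
      using independent_imp_joint_value[OF m13 _ x y] by (auto simp: e_iff)
    have "m (e {1}) x = m (e {1, 4}) x"
      by (rule mass_eq) (use x hval in \<open>auto simp: N4_def\<close>)
    then have "e {1, 4} z = e {1, 4} x"
      by (rule value_eq_if_mass_eq) (use z in \<open>auto simp: e_iff\<close>)
    then have "e {4} z = e {4} x" by (simp add: e_iff)
    then have "m (e {1}) z = m (e {1}) x" "m (e {3}) z = m (e {3}) y" "m (e {4}) z = m (e {4}) x"
      using z by (auto intro: mass_cong)
    then show ?thesis
      using key[OF x] key[OF z(1)] mass_pos[OF x, of "e {4}"] by simp
  qed
  then have "ent \<Omega> p (e {3}) = log 2 (card (e {3} ` \<Omega>)) \<and> 1 \<le> card (e {3} ` \<Omega>)"
    by (rule ent_uniform)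
  moreover have "ent \<Omega> p (e {3}) = a" using ent[of "{3}"] hval by (simp add: N4_def)
  ultimately show ?thesis by metis
qed

theorem mainTheorem9:
  fixes a b :: real and F :: "(nat set \<Rightarrow> real) set" and h :: "nat set \<Rightarrow> real"
  assumes "F = pair_face (uniform_rank 2 {1, 2, 3}) (uniform_rank 1 {1, 2, 4})"
    and "0 \<le> a" and "0 \<le> b"
    and "h = pair_point (uniform_rank 2 {1, 2, 3}) (uniform_rank 1 {1, 2, 4}) a b"
    and "h \<in> F"
  shows "entropic h \<longleftrightarrow> (\<exists>v::nat. 1 \<le> v \<and> a = log 2 (real v))"
  using assms entropic_pair_point_imp_log entropic_pair_point_log by blast

end
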